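(* Let $S$, $\partial S$, $\Omega$, $\mathcal{H}$, $f$, $g$, the point sequences $\{x_j\}_{j=1}^\infty\subset S$ and $\{y_j\}_{j=1}^\infty\subset\partial S$, the discrete solutions $u_c^{(\tilde N)}$, the fill distance $h_{\max}$, and the minimizers $\tilde c_{\tilde N}$ be as in the context. Let $p>0$ and suppose that $\mathcal{H}$ produces a $p$-th order method in the following sense: for every bounded interval $I\subset\mathbb{R}$ there are constants $A_p,B_p,h_0>0$ such that for every $c\in I$ and all $\tilde N,\tilde N_\partial$ with $h_{\max}<h_0$, $$\left|\Delta_S u_c^{(\tilde N)}-(f-cg)\right|\le A_p\,h_{\max}^p\,\big\|u_c^{(\tilde N)}\big\|_{\mathcal{H}}\quad\text{on } S,$$ $$\left|\hat n_{\partial S}\cdot\nabla_S u_c^{(\tilde N)}\right|\le B_p\,h_{\max}^p\,\big\|u_c^{(\tilde N)}\big\|_{\mathcal{H}}\quad\text{on }\partial S$$ (the second bound being omitted if $S$ is a closed surface). Let $c_*=\int_S f\big/\int_S g$ and suppose there exists $u_{c_*}\in\mathcal{H}$ whose restriction to $S$ is an exact strong-form solution of $$\Delta_S u=f-c_*g\ \text{ on } S,\qquad \hat n_{\partial S}\cdot\nabla_S u\big|_{\partial S}=0$$ (with the boundary condition removed if $S$ is closed). Then there is a constant $\tilde A_p>0$, independent of $\tilde N,\tilde N_\partial$, such that for all sufficiently small $h_{\max}$, $$\left|\tilde c_{\tilde N}\int_S g-\int_S f\right|\le\tilde A_p\,h_{\max}^p\,\|u_{c_*}\|_{\mathcal{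H}}=O\!\left(h_{\max}^p\right).$$
   Context: Setting. $S\subset\Omega\subset\mathbb{R}^m$ is a domain of integration, either a bounded flat domain or a compact embedded surface, with boundary $\partial S$ or closed (without boundary). $S$ and $\partial S$ have finite measure $|S|=\int_S 1$, $|\partial S|=\int_{\partial S}1$. $\nabla_S$ is the surface gradient and $\Delta_S$ the Laplace-Beltrami operator on $S$ (the ordinary gradient and Laplacian if $S$ is flat), applied to a function on $\Omega$ through its restriction to $S$. $\hat n_{\partial S}$ is the outward unit conormal along $\partial S$ (tangential to $S$ and normal to $\partial S$). $\mathcal{H}$ is a Hilbert space of functions on $\Omega$, smooth enough that $\Delta_S u$ and $\hat n_{\partial S}\cdot\nabla_S u$ are defined pointwise and continuous on $S$ and $\partial S$ respectively for all $u\in\mathcal{H}$. $S$ is regular enough that the divergence theorem $\int_S\Delta_S u=\int_{\partial S}\hat n_{\partial S}\cdot\nabla_S u$ holds for $u\in\mathcal{H}$ (with right-hand side $0$ if $S$ is closed). The functions $f,g$ are real-valued, integrable and continuous on $S$, and $\int_S g>0$. Discrete problem. $\{x_j\}_{j=1}^\infty$ is dense in $S$ and $\{y_j\}_{j=1}^\infty$ is dense in $\partial S$. For $c\in\mathbb{R}$ and integers $\tilde N,\tilde N_\partial$, let $u_c^{(\tilde N)}$ be the solution of: minimize $\|u\|_{\mathcal{H}}$ over $u\in\mathcal{H}$ subject to $\Delta_S u(x_j)=f(x_j)-c\,g(x_j)$ for $j=1,\dots,\tilde N$, and $(\hat n_{\partial S}\cdot\nabla_S u)(y_j)=0$ for $j=1,\dots,\tilde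 N_\partial$ (the latter conditions being dropped if $S$ is closed). It is assumed that the linear map $\mathcal{L}:\mathcal{H}\to\mathbb{C}^{\tilde N+\tilde N_\partial}$ sending $u$ to the vector of all values $\Delta_S u(x_j)$, $(\hat n_{\partial S}\cdot\nabla_S u)(y_j)$ appearing in the constraints is bounded and surjective, so that $u_c^{(\tilde N)}$ exists and is unique for every $c$. The dependence on $\tilde N_\partial$ is suppressed in the notation; $\tilde N,\tilde N_\partial\to\infty$ together. The fill distance of a finite set $\{z_j\}$ in a set $D$ is $\sup_{z\in D}\min_j\|z-z_j\|_2$. $h_{\max}$ denotes a common fill distance for the collocation points, i.e. the larger of the fill distance of $\{x_j\}_{j=1}^{\tilde N}$ in $S$ and that of $\{y_j\}_{j=1}^{\tilde N_\partial}$ in $\partial S$ (only the former if $S$ is closed). $\tilde c_{\tilde N}$ denotes the minimizer over $c\in\mathbb{R}$ of $\big\|u_c^{(\tilde N)}\big\|_{\mathcal{H}}$ (the square of this norm is a quadratic polynomial in $c$, with positive leading coefficient as soon as $g(x_j)\neq0$ for some $j\le\tilde N$). *)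

theory Defs
  imports "HOL-Analysis.Analysis"
begin

section \<open>Surface measure\<close>

text \<open>
  The factor \<open>unit_ball_vol k / 2^k\<close> normalises the \<open>k\<close>-dimensional Hausdorff measure so that it is
  the usual \<open>k\<close>-dimensional surface measure on \<open>k\<close>-dimensional submanifolds (Lebesgue measure if
  \<open>k\<close> is the dimension of the space, counting measure if \<open>k = 0\<close>). Empty covering sets are counted
  with weight \<open>0\<close> also for \<open>k = 0\<close>.
\<close>

definition hausdorff_outer :: "nat \<Rightarrow> 'a::metric_space set \<Rightarrow> ennreal" where
  "hausdorff_outer k A =
     (SUP \<delta>\<in>{0<..}. INF C\<in>{C :: nat \<Rightarrow> 'a set. A \<subseteq> (\<Union>i. C i) \<and> (\<forall>i. bounded (C i) \<and> diameter (C i) \<le> \<delta>)}.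
        (\<Sum>i. if C i = {} then 0
             else ennreal (unit_ball_vol (real k) * (diameter (C i) / 2) ^ k)))"

text \<open>
  This is a metric outer measure, hence countably additive on the Borel sets, so that
  \<open>measure_of\<close> does not collapse to the zero measure.
\<close>

definition hausdorff_measure :: "nat \<Rightarrow> 'a::metric_space measure" where
  "hausdorff_measure k = measure_of UNIV (sets borel) (hausdorff_outer k)"

section \<open>Embedded submanifolds with boundary\<close>

text \<open>
  Class \<open>C\<^sup>1\<close> is all that tangent spaces and conormals need; any further regularity of the surface
  is part of the assumptions made on the function space.
\<close>

definition C1_on :: "'a::euclidean_space set \<Rightarrow> ('a \<Rightarrow> 'a) \<Rightarrow> bool" where
  "C1_on U \<phi> \<longleftrightarrow>
     (\<exists>\<phi>' :: 'a \<Rightarrow> 'a \<Rightarrow>\<^sub>L 'a.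
        (\<forall>x\<in>U. (\<phi> has_derivative blinfun_apply (\<phi>' x)) (at x)) \<and> continuous_on U \<phi>')"

definition C1_diffeo :: "'a::euclidean_space set \<Rightarrow> 'a set \<Rightarrow> ('a \<Rightarrow> 'a) \<Rightarrow> bool" where
  "C1_diffeo U V \<phi> \<longleftrightarrow>
     open U \<and> open V \<and> \<phi> ` U = V \<and> C1_on U \<phi> \<and> (\<exists>\<psi>. C1_on V \<psi> \<and> (\<forall>x\<in>U. \<psi> (\<phi> x) = x))"

definition interior_point :: "nat \<Rightarrow> 'a::euclidean_space set \<Rightarrow> 'a \<Rightarrow> bool" where
  "interior_point k M p \<longleftrightarrow>
     (\<exists>U V \<phi> E. p \<in> M \<inter> U \<and> C1_diffeo U V \<phi> \<and> subspace E \<and> dim E = k \<and> \<phi> ` (M \<inter> U) = V \<inter> E)"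

definition boundary_point :: "nat \<Rightarrow> 'a::euclidean_space set \<Rightarrow> 'a \<Rightarrow> bool" where
  "boundary_point k M p \<longleftrightarrow>
     (\<exists>U V \<phi> E a. p \<in> M \<inter> U \<and> C1_diffeo U V \<phi> \<and> subspace E \<and> dim E = k \<and> a \<in> E \<and> a \<noteq> 0 \<and>
        \<phi> ` (M \<inter> U) = V \<inter> {x\<in>E. 0 \<le> a \<bullet> x} \<and> a \<bullet> \<phi> p = 0)"

definition embedded_submanifold :: "nat \<Rightarrow> 'a::euclidean_space set \<Rightarrow> bool" where
  "embedded_submanifold k M \<longleftrightarrow> (\<forall>p\<in>M. interior_point k M p \<or> boundary_point k M p)"

text \<open>
  A domain of integration of dimension \<open>k\<close>: either a bounded flat domain (open, lying locally on one
  side of its boundary), or a compact embedded surface; the latter case includes \<open>k = DIM('a)\<close>, that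
  is, flat domains taken together with their boundary.
\<close>

definition integration_domain :: "nat \<Rightarrow> 'a::euclidean_space set \<Rightarrow> bool" where
  "integration_domain k S \<longleftrightarrow> 1 \<le> k \<and>
     (k = DIM('a) \<and> open S \<and> bounded S \<and> interior (closure S) = S \<and> embedded_submanifold k (closure S)
      \<or> compact S \<and> embedded_submanifold k S)"

text \<open>
  The closure only matters for an open flat domain, whose boundary is then its frontier.
\<close>

definition surface_boundary :: "nat \<Rightarrow> 'a::euclidean_space set \<Rightarrow> 'a set" where
  "surface_boundary k S = {p. boundary_point k (closure S) p}"

section \<open>Tangential calculus\<close>

text \<open>
  One-sided velocities are used so that the span is the full \<open>k\<close>-dimensional tangent space at
  boundary points as well.
\<close>

definition tangent_directions :: "'a::euclidean_space set \<Rightarrow> 'a \<Rightarrow> 'a set" where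
  "tangent_directions M p =
     {v. \<exists>\<gamma> :: real \<Rightarrow> 'a. \<gamma> 0 = p \<and> (\<forall>t\<ge>0. \<gamma> t \<in> M) \<and> (\<gamma> has_vector_derivative v) (at 0 within {0..})}"

definition tangent_space :: "'a::euclidean_space set \<Rightarrow> 'a \<Rightarrow> 'a set" where
  "tangent_space M p = span (tangent_directions M p)"

text \<open>
  The derivative is taken within \<open>closure S\<close>: for a compact surface only the restriction to \<open>S\<close>
  matters, and for an open flat domain these are the ordinary gradient on \<open>S\<close> and its one-sided
  version on the boundary.
\<close>

definition has_surface_grad :: "'a::euclidean_space set \<Rightarrow> ('a \<Rightarrow> real) \<Rightarrow> 'a \<Rightarrow> 'a \<Rightarrow> bool" where
  "has_surface_grad S u p w \<longleftrightarrow>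
     w \<in> tangent_space (closure S) p \<and> (u has_derivative (\<lambda>v. w \<bullet> v)) (at p within closure S)"

definition surface_grad :: "'a::euclidean_space set \<Rightarrow> ('a \<Rightarrow> real) \<Rightarrow> 'a \<Rightarrow> 'a" where
  "surface_grad S u p = (THE w. has_surface_grad S u p w)"

definition orthonormal_basis_of :: "'a::euclidean_space set \<Rightarrow> 'a set \<Rightarrow> bool" where
  "orthonormal_basis_of T B \<longleftrightarrow> B \<subseteq> T \<and> pairwise orthogonal B \<and> (\<forall>b\<in>B. norm b = 1) \<and> span B = T"

text \<open>
  The surface divergence is the trace of the derivative over the tangent space. It depends neither on
  the choice of the basis nor on the extension of the derivative beyond the tangent space.
\<close>

definition surface_div :: "'a::euclidean_space set \<Rightarrow> ('a \<Rightarrow> 'a) \<Rightarrow> 'a \<Rightarrow> real" where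
  "surface_div S X p =
     (\<Sum>b\<in>(SOME B. orthonormal_basis_of (tangent_space (closure S) p) B).
        frechet_derivative X (at p within closure S) b \<bullet> b)"

definition outward_conormal :: "nat \<Rightarrow> 'a::euclidean_space set \<Rightarrow> 'a \<Rightarrow> 'a" where
  "outward_conormal k S y =
     (THE \<nu>. norm \<nu> = 1 \<and> \<nu> \<in> tangent_space (closure S) y \<and>
        (\<forall>w\<in>tangent_space (surface_boundary k S) y. \<nu> \<bullet> w = 0) \<and>
        - \<nu> \<in> tangent_directions (closure S) y)"

definition laplace_beltrami :: "'a::euclidean_space set \<Rightarrow> ('a \<Rightarrow> complex) \<Rightarrow> 'a \<Rightarrow> complex" where
  "laplace_beltrami S u p =
     Complex (surface_div S (surface_grad S (\<lambda>x. Re (u x))) p)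
             (surface_div S (surface_grad S (\<lambda>x. Im (u x))) p)"

definition normal_derivative :: "nat \<Rightarrow> 'a::euclidean_space set \<Rightarrow> ('a \<Rightarrow> complex) \<Rightarrow> 'a \<Rightarrow> complex" where
  "normal_derivative k S u y =
     Complex (outward_conormal k S y \<bullet> surface_grad S (\<lambda>x. Re (u x)) y)
             (outward_conormal k S y \<bullet> surface_grad S (\<lambda>x. Im (u x)) y)"

definition laplacian_defined_at :: "'a::euclidean_space set \<Rightarrow> ('a \<Rightarrow> complex) \<Rightarrow> 'a \<Rightarrow> bool" where
  "laplacian_defined_at S u p \<longleftrightarrow>
     (\<forall>v\<in>{\<lambda>x. Re (u x), \<lambda>x. Im (u x)}.
        (\<exists>w. has_surface_grad S v p w) \<and> surface_grad S v differentiable (at p within closure S))"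

definition gradient_defined_at :: "'a::euclidean_space set \<Rightarrow> ('a \<Rightarrow> complex) \<Rightarrow> 'a \<Rightarrow> bool" where
  "gradient_defined_at S u p \<longleftrightarrow>
     (\<forall>v\<in>{\<lambda>x. Re (u x), \<lambda>x. Im (u x)}. \<exists>w. has_surface_grad S v p w)"

definition smooth_enough :: "nat \<Rightarrow> 'a::euclidean_space set \<Rightarrow> ('a \<Rightarrow> complex) \<Rightarrow> bool" where
  "smooth_enough k S u \<longleftrightarrow>
     (\<forall>p\<in>S. laplacian_defined_at S u p) \<and> continuous_on S (laplace_beltrami S u) \<and>
     (\<forall>y\<in>surface_boundary k S. gradient_defined_at S u y) \<and>
     continuous_on (surface_boundary k S) (normal_derivative k S u)"

text \<open>For a closed surface the right-hand side is an integral over the empty set.\<close>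

definition divergence_theorem :: "nat \<Rightarrow> 'a::euclidean_space set \<Rightarrow> ('a \<Rightarrow> complex) \<Rightarrow> bool" where
  "divergence_theorem k S u \<longleftrightarrow>
     set_integrable (hausdorff_measure k) S (laplace_beltrami S u) \<and>
     set_integrable (hausdorff_measure (k - 1)) (surface_boundary k S) (normal_derivative k S u) \<and>
     (LINT z:S|hausdorff_measure k. laplace_beltrami S u z) =
       (LINT z:surface_boundary k S|hausdorff_measure (k - 1). normal_derivative k S u z)"

section \<open>Hilbert spaces of functions\<close>

text \<open>
  A complex Hilbert space \<open>H\<close> of functions on \<open>\<Omega>\<close> with inner product \<open>ip\<close>. A function on \<open>\<Omega>\<close> is
  represented by its extension by zero.
\<close>

definition hnorm :: "(('a \<Rightarrow> complex) \<Rightarrow> ('a \<Rightarrow> complex) \<Rightarrow> complex) \<Rightarrow> ('a \<Rightarrow> complex) \<Rightarrow> real" where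
  "hnorm ip u = sqrt (Re (ip u u))"

definition hilbert_function_space ::
  "'a set \<Rightarrow> ('a \<Rightarrow> complex) set \<Rightarrow> (('a \<Rightarrow> complex) \<Rightarrow> ('a \<Rightarrow> complex) \<Rightarrow> complex) \<Rightarrow> bool" where
  "hilbert_function_space \<Omega> H ip \<longleftrightarrow>
     (\<forall>u\<in>H. \<forall>x. x \<notin> \<Omega> \<longrightarrow> u x = 0) \<and>
     (\<lambda>x. 0) \<in> H \<and>
     (\<forall>u\<in>H. \<forall>v\<in>H. (\<lambda>x. u x + v x) \<in> H) \<and>
     (\<forall>a. \<forall>u\<in>H. (\<lambda>x. a * u x) \<in> H) \<and>
     (\<forall>u\<in>H. \<forall>v\<in>H. \<forall>w\<in>H. ip (\<lambda>x. u x + v x) w = ip u w + ip v w) \<and>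
     (\<forall>a. \<forall>u\<in>H. \<forall>v\<in>H. ip (\<lambda>x. a * u x) v = a * ip u v) \<and>
     (\<forall>u\<in>H. \<forall>v\<in>H. ip u v = cnj (ip v u)) \<and>
     (\<forall>u\<in>H. 0 \<le> Re (ip u u)) \<and>
     (\<forall>u\<in>H. ip u u = 0 \<longrightarrow> u = (\<lambda>x. 0)) \<and>
     (\<forall>s :: nat \<Rightarrow> 'a \<Rightarrow> complex.
        range s \<subseteq> H \<and> (\<forall>e>0. \<exists>N. \<forall>m\<ge>N. \<forall>n\<ge>N. hnorm ip (\<lambda>x. s m x - s n x) < e) \<longrightarrow>
        (\<exists>u\<in>H. (\<lambda>n. hnorm ip (\<lambda>x. s n x - u x)) \<longlonglongrightarrow> 0))"

section \<open>The discrete problem\<close>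

definition fill_distance :: "'a::metric_space set \<Rightarrow> (nat \<Rightarrow> 'a) \<Rightarrow> nat \<Rightarrow> real" where
  "fill_distance D z N = (SUP w\<in>D. Min ((\<lambda>j. dist w (z j)) ` {1..N}))"

definition h_max ::
  "nat \<Rightarrow> 'a::euclidean_space set \<Rightarrow> (nat \<Rightarrow> 'a) \<Rightarrow> (nat \<Rightarrow> 'a) \<Rightarrow> nat \<Rightarrow> nat \<Rightarrow> real" where
  "h_max k S x y N Nb =
     (if surface_boundary k S = {} then fill_distance S x N
      else max (fill_distance S x N) (fill_distance (surface_boundary k S) y Nb))"

text \<open>
  The values of \<open>u\<close> under the sampling map \<open>\<L>\<close> are \<open>a 1, \<dots>, a N\<close> at the interior points and
  \<open>b 1, \<dots>, b Nb\<close> at the boundary points; the latter are dropped for a closed surface.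
\<close>

definition sampled_values ::
  "nat \<Rightarrow> 'a::euclidean_space set \<Rightarrow> (nat \<Rightarrow> 'a) \<Rightarrow> (nat \<Rightarrow> 'a) \<Rightarrow> nat \<Rightarrow> nat \<Rightarrow>
   (nat \<Rightarrow> complex) \<Rightarrow> (nat \<Rightarrow> complex) \<Rightarrow> ('a \<Rightarrow> complex) \<Rightarrow> bool" where
  "sampled_values k S x y N Nb a b u \<longleftrightarrow>
     (\<forall>j\<in>{1..N}. laplace_beltrami S u (x j) = a j) \<and>
     (surface_boundary k S \<noteq> {} \<longrightarrow> (\<forall>j\<in>{1..Nb}. normal_derivative k S u (y j) = b j))"

definition sampling_surjective ::
  "nat \<Rightarrow> 'a::euclidean_space set \<Rightarrow> (nat \<Rightarrow> 'a) \<Rightarrow> (nat \<Rightarrow> 'a) \<Rightarrow> nat \<Rightarrow> nat \<Rightarrow> ('a \<Rightarrow> complex) set \<Rightarrow> bool" where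
  "sampling_surjective k S x y N Nb H \<longleftrightarrow> (\<forall>a b. \<exists>u\<in>H. sampled_values k S x y N Nb a b u)"

definition sampling_bounded ::
  "nat \<Rightarrow> 'a::euclidean_space set \<Rightarrow> (nat \<Rightarrow> 'a) \<Rightarrow> (nat \<Rightarrow> 'a) \<Rightarrow> nat \<Rightarrow> nat \<Rightarrow> ('a \<Rightarrow> complex) set \<Rightarrow>
   (('a \<Rightarrow> complex) \<Rightarrow> ('a \<Rightarrow> complex) \<Rightarrow> complex) \<Rightarrow> bool" where
  "sampling_bounded k S x y N Nb H ip \<longleftrightarrow>
     (\<exists>K. \<forall>u\<in>H.
        (\<forall>j\<in>{1..N}. cmod (laplace_beltrami S u (x j)) \<le> K * hnorm ip u) \<and>
        (surface_boundary k S \<noteq> {} \<longrightarrow>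
           (\<forall>j\<in>{1..Nb}. cmod (normal_derivative k S u (y j)) \<le> K * hnorm ip u)))"

definition discrete_solution ::
  "nat \<Rightarrow> 'a::euclidean_space set \<Rightarrow> ('a \<Rightarrow> complex) set \<Rightarrow> (('a \<Rightarrow> complex) \<Rightarrow> ('a \<Rightarrow> complex) \<Rightarrow> complex) \<Rightarrow>
   ('a \<Rightarrow> real) \<Rightarrow> ('a \<Rightarrow> real) \<Rightarrow> (nat \<Rightarrow> 'a) \<Rightarrow> (nat \<Rightarrow> 'a) \<Rightarrow> nat \<Rightarrow> nat \<Rightarrow> real \<Rightarrow> 'a \<Rightarrow> complex" where
  "discrete_solution k S H ip f g x y N Nb c =
     arg_min_on (hnorm ip)
       {u\<in>H. sampled_values k S x y N Nb (\<lambda>j. of_real (f (x j) - c * g (x j))) (\<lambda>j. 0) u}"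

definition c_tilde ::
  "nat \<Rightarrow> 'a::euclidean_space set \<Rightarrow> ('a \<Rightarrow> complex) set \<Rightarrow> (('a \<Rightarrow> complex) \<Rightarrow> ('a \<Rightarrow> complex) \<Rightarrow> complex) \<Rightarrow>
   ('a \<Rightarrow> real) \<Rightarrow> ('a \<Rightarrow> real) \<Rightarrow> (nat \<Rightarrow> 'a) \<Rightarrow> (nat \<Rightarrow> 'a) \<Rightarrow> nat \<Rightarrow> nat \<Rightarrow> real" where
  "c_tilde k S H ip f g x y N Nb =
     arg_min (\<lambda>c. hnorm ip (discrete_solution k S H ip f g x y N Nb c)) (\<lambda>c. True)"

end

theory Submission
  imports Defs
begin

text \<open>
  By the divergence theorem the defect \<open>\<integral>\<^sub>S f - c \<integral>\<^sub>S g\<close> is the integral of the residuals of any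
  discrete solution for \<open>c\<close>, hence it is at most a multiple of \<open>h\<^sup>p \<parallel>u\<^sub>c\<parallel>\<close>. For the minimizing
  \<open>c\<close> the norm is at most that of \<open>u\<close> for \<open>c\<^sub>*\<close>, which is at most that of the exact solution because
  the latter satisfies the constraints. The constants of the method are only uniform for bounded \<open>c\<close>,
  but once a point \<open>x J\<close> with \<open>g (x J) \<noteq> 0\<close> is sampled, the minimizers are controlled by the norm of
  one bounded functional. For small \<open>h\<close> this point is sampled, since surjectivity of the sampling map
  makes the points distinct and thus keeps the fill distance of the first \<open>J - 1\<close> points positive.
\<close>

section \<open>Tangential calculus: uniqueness and linearity of the surface operators\<close>

text \<open>Along a curve in \<open>M\<close> starting at \<open>p\<close> the chain rule turns both
  derivatives into the one-sided derivative of the same real-variable function, which is unique.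
  Linearity carries the agreement from velocities to their span. Off the tangent space the two
  derivatives may differ.\<close>

lemma has_derivative_unique_on_tangent_space:
  fixes F :: "'a::euclidean_space \<Rightarrow> 'b::real_normed_vector"
  assumes D: "(F has_derivative D) (at p within M)" and E: "(F has_derivative E) (at p within M)"
    and v: "v \<in> tangent_space M p"
  shows "D v = E v"
proof -
  have lin: "linear D" "linear E"
    using D E by (auto intro: has_derivative_linear)
  have dir: "D w = E w" if w: "w \<in> tangent_directions M p" for w
  proof -
    obtain \<gamma> :: "real \<Rightarrow> 'a" where \<gamma>: "\<gamma> 0 = p" "\<And>t. t \<ge> 0 \<Longrightarrow> \<gamma> t \<in> M"
      "(\<gamma> has_vector_derivative w) (at 0 within {0..})"
      using w by (auto simp: tangent_directions_def)
    have chain: "((F \<circ> \<gamma>) has_vector_derivative G w) (at 0 within {0..})"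
      if G: "(F has_derivative G) (at p within M)" for G
    proof -
      have "(F has_derivative G) (at (\<gamma> 0) within \<gamma> ` {0..})"
        using G \<gamma> by (auto intro: has_derivative_subset)
      then have "((F \<circ> \<gamma>) has_derivative (G \<circ> (\<lambda>t. t *\<^sub>R w))) (at 0 within {0..})"
        using \<gamma>(3) unfolding has_vector_derivative_def by (rule diff_chain_within[rotated])
      moreover have "G \<circ> (\<lambda>t. t *\<^sub>R w) = (\<lambda>t. t *\<^sub>R G w)"
        using has_derivative_linear[OF G] by (auto simp: linear_scale)
      ultimately show ?thesis
        by (simp add: has_vector_derivative_def)
    qed
    have "at (0::real) within {0..} \<noteq> bot"
      by (simp add: at_within_Ici_at_right)
    then show ?thesis
      using vector_derivative_unique_within chain[OF D] chain[OF E] by blast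
  qed
  show ?thesis
    using linear_eq_on_span[OF lin dir] v by (auto simp: tangent_space_def)
qed

text \<open>This makes the \<open>THE\<close> in \<open>surface_grad\<close> well defined: the
  difference of two candidates is tangential, both derivatives agree on it, so it is orthogonal to
  itself.\<close>

lemma surface_grad_eqI:
  assumes "has_surface_grad S u p w"
  shows "surface_grad S u p = w"
  unfolding surface_grad_def
proof (rule the_equality)
  show "has_surface_grad S u p w" by (rule assms)
next
  fix z assume z: "has_surface_grad S u p z"
  have sub: "z - w \<in> tangent_space (closure S) p"
    using assms z unfolding has_surface_grad_def tangent_space_def by (auto intro: span_diff)
  have "z \<bullet> (z - w) = w \<bullet> (z - w)"
    using has_derivative_unique_on_tangent_space[OF _ _ sub] assms z
    unfolding has_surface_grad_def by metis
  then have "(z - w) \<bullet> (z - w) = 0"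
    by (simp add: inner_diff_left)
  then show "z = w" by simp
qed

lemma has_surface_grad_lincomb:
  assumes "has_surface_grad S u p w" "has_surface_grad S v p z"
  shows "has_surface_grad S (\<lambda>x. a * u x + b * v x) p (a *\<^sub>R w + b *\<^sub>R z)"
  using assms unfolding has_surface_grad_def tangent_space_def
  by (auto intro!: span_add span_mul derivative_eq_intros simp: inner_add_left)

lemma surface_grad_lincomb:
  assumes "\<exists>w. has_surface_grad S u p w" "\<exists>w. has_surface_grad S v p w"
  shows "surface_grad S (\<lambda>x. a * u x + b * v x) p =
    a *\<^sub>R surface_grad S u p + b *\<^sub>R surface_grad S v p"
  using assms by (auto simp: surface_grad_eqI has_surface_grad_lincomb)

text \<open>\<open>frechet_derivative\<close> picks one of possibly many derivatives within a
  surface, but the trace only evaluates it at tangent vectors, where all of them agree. The basis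
  depends only on \<open>S\<close> and \<open>p\<close>, so the right-hand side is visibly linear in
  \<open>D\<close>.\<close>

lemma surface_div_eqI:
  assumes X: "(X has_derivative D) (at p within closure S)"
  shows "surface_div S X p =
    (\<Sum>b\<in>(SOME B. orthonormal_basis_of (tangent_space (closure S) p) B). D b \<bullet> b)"
proof -
  let ?T = "tangent_space (closure S) p"
  have "subspace ?T"
    by (simp add: tangent_space_def)
  then have "\<exists>B. orthonormal_basis_of ?T B"
    unfolding orthonormal_basis_of_def by (metis orthonormal_basis_subspace)
  then have B: "orthonormal_basis_of ?T (SOME B. orthonormal_basis_of ?T B)"
    by (rule someI_ex)
  have "X differentiable (at p within closure S)"
    using X by (auto simp: differentiable_def)
  then have "(X has_derivative frechet_derivative X (at p within closure S)) (at p within closure S)"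
    using frechet_derivative_works by blast
  then have "frechet_derivative X (at p within closure S) b = D b" if "b \<in> ?T" for b
    using X that by (rule has_derivative_unique_on_tangent_space)
  with B show ?thesis
    unfolding surface_div_def orthonormal_basis_of_def by (intro sum.cong) auto
qed

lemma surface_div_grad_lincomb:
  assumes p: "p \<in> S" and S: "open S \<or> closed S"
    and grad: "\<And>q. q \<in> S \<Longrightarrow> \<exists>w. has_surface_grad S u q w" "\<And>q. q \<in> S \<Longrightarrow> \<exists>w. has_surface_grad S v q w"
    and diff: "surface_grad S u differentiable (at p within closure S)"
      "surface_grad S v differentiable (at p within closure S)"
  shows "surface_div S (surface_grad S (\<lambda>x. a * u x + b * v x)) p =
    a * surface_div S (surface_grad S u) p + b * surface_div S (surface_grad S v) p"
proof -
  obtain D E where D: "(surface_grad S u has_derivative D) (at p within closure S)"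
    and E: "(surface_grad S v has_derivative E) (at p within closure S)"
    using diff by (auto simp: differentiable_def)
  have "((\<lambda>q. a *\<^sub>R surface_grad S u q + b *\<^sub>R surface_grad S v q) has_derivative
      (\<lambda>t. a *\<^sub>R D t + b *\<^sub>R E t)) (at p within closure S)"
    using D E by (auto intro!: derivative_intros)
  \<comment> \<open>Gradients are known to exist only on \<open>S\<close>, while the derivative is
    taken within \<open>closure S\<close>. For open or closed \<open>S\<close> the two sets coincide
    near \<open>p\<close>, so linearity of the gradient on \<open>S\<close> suffices.\<close>
  moreover have "eventually (\<lambda>q. q \<in> S) (at p within closure S)"
    using S p by (auto simp: eventually_at_filter eventually_nhds closure_closed)
  then have "\<forall>\<^sub>F q in at p within closure S. a *\<^sub>R surface_grad S u q + b *\<^sub>R surface_grad S v q =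
      surface_grad S (\<lambda>x. a * u x + b * v x) q"
    by (rule eventually_mono) (use grad in \<open>simp add: surface_grad_lincomb\<close>)
  moreover have "a *\<^sub>R surface_grad S u p + b *\<^sub>R surface_grad S v p =
      surface_grad S (\<lambda>x. a * u x + b * v x) p"
    using grad(1)[OF p] grad(2)[OF p] by (rule surface_grad_lincomb[symmetric])
  moreover have "p \<in> closure S"
    using p closure_subset by blast
  ultimately have "(surface_grad S (\<lambda>x. a * u x + b * v x) has_derivative
      (\<lambda>t. a *\<^sub>R D t + b *\<^sub>R E t)) (at p within closure S)"
    by (rule has_derivative_transform_eventually)
  from surface_div_eqI[OF this] surface_div_eqI[OF D] surface_div_eqI[OF E] show ?thesis
    by (simp add: inner_add_left sum.distrib sum_distrib_left)
qed

text \<open>Real coefficients act separately on real and imaginary parts, which reduces the claim to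
  real-valued functions.\<close>

lemma laplace_beltrami_lincomb:
  assumes p: "p \<in> S" and S: "open S \<or> closed S"
    and u: "\<And>q. q \<in> S \<Longrightarrow> laplacian_defined_at S u q" and v: "\<And>q. q \<in> S \<Longrightarrow> laplacian_defined_at S v q"
  shows "laplace_beltrami S (\<lambda>x. of_real a * u x + of_real b * v x) p =
    of_real a * laplace_beltrami S u p + of_real b * laplace_beltrami S v p"
  using u v p
  by (simp add: laplace_beltrami_def laplacian_defined_at_def surface_div_grad_lincomb[OF p S]
      complex_eq_iff)

lemma normal_derivative_lincomb:
  assumes "gradient_defined_at S u y" "gradient_defined_at S v y"
  shows "normal_derivative k S (\<lambda>x. of_real a * u x + of_real b * v x) y =
    of_real a * normal_derivative k S u y + of_real b * normal_derivative k S v y"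
  using assms
  by (simp add: normal_derivative_def gradient_defined_at_def surface_grad_lincomb
      complex_eq_iff inner_add_right)

section \<open>Minimal norm in closed affine subsets of the function space\<close>

locale hilbert_functions =
  fixes \<Omega> :: "'a set" and H :: "('a \<Rightarrow> complex) set"
    and ip :: "('a \<Rightarrow> complex) \<Rightarrow> ('a \<Rightarrow> complex) \<Rightarrow> complex"
  assumes hilbert: "hilbert_function_space \<Omega> H ip"
begin

lemma add_in: "u \<in> H \<Longrightarrow> v \<in> H \<Longrightarrow> (\<lambda>x. u x + v x) \<in> H"
  and scale_in: "u \<in> H \<Longrightarrow> (\<lambda>x. a * u x) \<in> H"
  and ip_add: "u \<in> H \<Longrightarrow> v \<in> H \<Longrightarrow> w \<in> H \<Longrightarrow> ip (\<lambda>x. u x + v x) w = ip u w + ip v w"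
  and ip_scale: "u \<in> H \<Longrightarrow> v \<in> H \<Longrightarrow> ip (\<lambda>x. a * u x) v = a * ip u v"
  and ip_cnj: "u \<in> H \<Longrightarrow> v \<in> H \<Longrightarrow> ip u v = cnj (ip v u)"
  and ip_nonneg: "u \<in> H \<Longrightarrow> 0 \<le> Re (ip u u)"
  and complete: "range s \<subseteq> H \<Longrightarrow>
      \<forall>e>0. \<exists>N. \<forall>m\<ge>N. \<forall>n\<ge>N. hnorm ip (\<lambda>x. s m x - s n x) < e \<Longrightarrow>
      \<exists>u\<in>H. (\<lambda>n. hnorm ip (\<lambda>x. s n x - u x)) \<longlonglongrightarrow> 0"
  using hilbert unfolding hilbert_function_space_def by blast+

lemma lincomb_in: "u \<in> H \<Longrightarrow> v \<in> H \<Longrightarrow> (\<lambda>x. a * u x + b * v x) \<in> H"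
  by (intro add_in scale_in)

lemma diff_in: "u \<in> H \<Longrightarrow> v \<in> H \<Longrightarrow> (\<lambda>x. u x - v x) \<in> H"
  using lincomb_in[of u v 1 "-1"] by simp

lemma hnorm_nonneg: "u \<in> H \<Longrightarrow> 0 \<le> hnorm ip u"
  by (simp add: hnorm_def ip_nonneg)

text \<open>The coefficient pairs \<open>(1, -1)\<close>, \<open>(1/2, 1/2)\<close> and
  \<open>(2, -1)\<close> supply every instance of the parallelogram law needed for the minimal norm
  argument.\<close>

lemma hnorm_lincomb:
  assumes u: "u \<in> H" and v: "v \<in> H"
  shows "(hnorm ip (\<lambda>x. of_real a * u x + of_real b * v x))\<^sup>2 =
    a\<^sup>2 * (hnorm ip u)\<^sup>2 + b\<^sup>2 * (hnorm ip v)\<^sup>2 + 2 * a * b * Re (ip u v)"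
proof -
  have sym: "Re (ip w z) = Re (ip z w)" if "w \<in> H" "z \<in> H" for w z
    by (subst ip_cnj) (use that in auto)
  have sq: "(hnorm ip w)\<^sup>2 = Re (ip w w)" if "w \<in> H" for w
    using that by (simp add: hnorm_def ip_nonneg)
  let ?w = "\<lambda>x. of_real a * u x + of_real b * v x"
  have w: "?w \<in> H" using u v by (rule lincomb_in)
  have left: "Re (ip ?w z) = a * Re (ip u z) + b * Re (ip v z)" if "z \<in> H" for z
    using u v that by (simp add: ip_add ip_scale scale_in)
  have "Re (ip ?w ?w) = a * Re (ip ?w u) + b * Re (ip ?w v)"
    using left[OF w] sym[OF w] u v by simp
  also have "\<dots> = a * (a * Re (ip u u) + b * Re (ip u v)) + b * (a * Re (ip u v) + b * Re (ip v v))"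
    using left u v sym[OF u v] by simp
  finally show ?thesis
    unfolding sq[OF u] sq[OF v] sq[OF w] by (simp add: power2_eq_square algebra_simps)
qed

lemma hnorm_diff:
  assumes "u \<in> H" "v \<in> H"
  shows "(hnorm ip (\<lambda>x. u x - v x))\<^sup>2 =
    (hnorm ip u)\<^sup>2 + (hnorm ip v)\<^sup>2 - 2 * Re (ip u v)"
  using hnorm_lincomb[OF assms, of 1 "-1"] by simp

text \<open>The classical projection argument: a minimizing sequence is Cauchy by the parallelogram
  law, and its limit stays in \<open>C\<close> and attains the infimum. \<open>C\<close> is affine
  and not merely convex, as \<open>t\<close> ranges over all reals.\<close>

lemma minimal_norm_exists:
  assumes sub: "C \<subseteq> H" and ne: "C \<noteq> {}"
    and aff: "\<And>u v t. u \<in> C \<Longrightarrow> v \<in> C \<Longrightarrow> (\<lambda>x. of_real (1 - t) * u x + of_real t * v x) \<in> C"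
    and cl: "\<And>s w. range s \<subseteq> C \<Longrightarrow> w \<in> H \<Longrightarrow> (\<lambda>n. hnorm ip (\<lambda>x. s n x - w x)) \<longlonglongrightarrow> 0 \<Longrightarrow> w \<in> C"
  shows "\<exists>u\<in>C. \<forall>v\<in>C. hnorm ip u \<le> hnorm ip v"
proof -
  define Q where "Q u = (hnorm ip u)\<^sup>2" for u
  define d where "d = (INF u\<in>C. Q u)"
  have bdd: "bdd_below (Q ` C)"
    by (intro bdd_belowI[of _ 0]) (auto simp: Q_def)
  have d_le: "d \<le> Q u" if "u \<in> C" for u
    unfolding d_def using bdd that by (rule cINF_lower)
  have "\<exists>u\<in>C. Q u < d + inverse (real (Suc n))" for n
    unfolding cINF_less_iff[OF ne bdd, symmetric] by (simp add: d_def)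
  then obtain s where s: "\<And>n. s n \<in> C" "\<And>n. Q (s n) < d + inverse (real (Suc n))"
    by metis
  have sH: "s n \<in> H" for n using s sub by blast
  have dist_sq: "Q (\<lambda>x. s m x - s n x) \<le> 2 * inverse (real (Suc m)) + 2 * inverse (real (Suc n))" for m n
  proof -
    \<comment> \<open>The midpoint lies in \<open>C\<close>, so its squared norm is at least
      \<open>d\<close>; this bounds the inner product from below and hence the squared distance by
      \<open>2 * Q (s m) + 2 * Q (s n) - 4 * d\<close>.\<close>
    have "d \<le> Q (\<lambda>x. of_real (1 - 1/2) * s m x + of_real (1/2) * s n x)"
      by (intro d_le aff s)
    also have "\<dots> = Q (s m) / 4 + Q (s n) / 4 + Re (ip (s m) (s n)) / 2"
      unfolding Q_def hnorm_lincomb[OF sH sH] by (simp add: power2_eq_square)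
    finally show ?thesis
      using s(2)[of m] s(2)[of n] hnorm_diff[OF sH sH, of m n] unfolding Q_def by linarith
  qed
  have "\<exists>N. \<forall>m\<ge>N. \<forall>n\<ge>N. hnorm ip (\<lambda>x. s m x - s n x) < e" if e: "e > 0" for e
  proof -
    obtain N where N: "inverse (real (Suc N)) < e\<^sup>2 / 4"
      using reals_Archimedean[of "e\<^sup>2 / 4"] e by auto
    have "hnorm ip (\<lambda>x. s m x - s n x) < e" if "m \<ge> N" "n \<ge> N" for m n
    proof -
      have "inverse (real (Suc m)) \<le> inverse (real (Suc N))"
        "inverse (real (Suc n)) \<le> inverse (real (Suc N))"
        using that by (auto simp: field_simps)
      then have "Q (\<lambda>x. s m x - s n x) < e\<^sup>2"
        using dist_sq[of m n] N by linarith
      then show ?thesis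
        using e unfolding Q_def by (simp add: power2_less_imp_less)
    qed
    then show ?thesis by blast
  qed
  moreover have "range s \<subseteq> H" using sH by blast
  ultimately obtain w where w: "w \<in> H" "(\<lambda>n. hnorm ip (\<lambda>x. s n x - w x)) \<longlonglongrightarrow> 0"
    using complete by blast
  have wC: "w \<in> C"
    using s w by (intro cl) auto
  \<comment> \<open>The reflection of \<open>w\<close> in \<open>s n\<close> lies in \<open>C\<close>, so the parallelogram law bounds the norm of \<open>w\<close>
    without the triangle inequality.\<close>
  have bound: "Q w \<le> 2 * inverse (real (Suc n)) + d + 2 * Q (\<lambda>x. s n x - w x)" for n
  proof -
    have "d \<le> Q (\<lambda>x. of_real (1 - (-1)) * s n x + of_real (-1) * w x)"
      by (intro d_le aff s wC)
    also have "\<dots> = 4 * Q (s n) + Q w - 4 * Re (ip (s n) w)"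
      unfolding Q_def hnorm_lincomb[OF sH w(1)] by simp
    finally show ?thesis
      using s(2)[of n] hnorm_diff[OF sH w(1), of n] unfolding Q_def by linarith
  qed
  have "(\<lambda>n. 2 * inverse (real (Suc n)) + d + 2 * Q (\<lambda>x. s n x - w x)) \<longlonglongrightarrow> 2 * 0 + d + 2 * 0\<^sup>2"
    unfolding Q_def by (intro tendsto_intros w LIMSEQ_inverse_real_of_nat)
  then have "Q w \<le> 2 * 0 + d + 2 * 0\<^sup>2"
    using bound by (intro LIMSEQ_le_const) auto
  then have "Q w \<le> Q v" if "v \<in> C" for v
    using d_le[OF that] by simp
  then have "hnorm ip w \<le> hnorm ip v" if "v \<in> C" for v
    using that sub hnorm_nonneg unfolding Q_def by (meson power2_le_imp_le subsetD)
  with wC show ?thesis by blast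
qed

end

section \<open>Minimizers, integral bounds and fill distances\<close>

lemma arg_min_on_minimal:
  fixes F :: "'a \<Rightarrow> 'b::linorder"
  assumes "\<exists>u\<in>C. \<forall>v\<in>C. F u \<le> F v"
  shows "arg_min_on F C \<in> C" "\<And>v. v \<in> C \<Longrightarrow> F (arg_min_on F C) \<le> F v"
proof -
  obtain u where u: "u \<in> C" "\<And>v. v \<in> C \<Longrightarrow> F u \<le> F v"
    using assms by blast
  have "arg_min_on F C \<in> C \<and> (\<forall>v\<in>C. F (arg_min_on F C) \<le> F v)"
    unfolding arg_min_on_def by (rule arg_minI[of "\<lambda>x. x \<in> C", OF u(1)]) (use u in \<open>auto simp: not_less\<close>)
  then show "arg_min_on F C \<in> C" "\<And>v. v \<in> C \<Longrightarrow> F (arg_min_on F C) \<le> F v"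
    by auto
qed

lemma norm_set_integral_le_const:
  fixes r :: "'a \<Rightarrow> 'b::{banach, second_countable_topology}"
  assumes r: "set_integrable M A r" and one: "set_integrable M A (\<lambda>_. 1 :: real)"
    and bound: "\<And>z. z \<in> A \<Longrightarrow> norm (r z) \<le> E"
  shows "norm (LINT z:A|M. r z) \<le> E * (LINT z:A|M. 1)"
proof -
  have E: "set_integrable M A (\<lambda>_. E)"
    using set_integrable_mult_right[OF one, of E] by simp
  have "norm (LINT z:A|M. r z) \<le> (LINT z:A|M. norm (r z))"
    using r by (rule set_integral_norm_bound)
  also have "\<dots> \<le> (LINT z:A|M. E)"
    using r E bound by (intro set_integral_mono set_integrable_norm)
  also have "\<dots> = E * (LINT z:A|M. 1)"
    using set_integral_mult_right[of M A E "\<lambda>_. 1"] by simp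
  finally show ?thesis .
qed

text \<open>A real-valued \<open>SUP\<close> dominates its members only if they are bounded above;
  here the distance to \<open>z 1\<close> is a bound because \<open>D\<close> is bounded.
  \<open>N \<ge> 1\<close> keeps the argument of \<open>Min\<close> nonempty.\<close>

lemma fill_distance_lower_bound:
  fixes z :: "nat \<Rightarrow> 'a::metric_space"
  assumes D: "bounded D" and w: "w \<in> D" and N: "N \<ge> 1"
    and far: "\<And>j. j \<in> {1..N} \<Longrightarrow> \<delta> \<le> dist w (z j)"
  shows "\<delta> \<le> fill_distance D z N"
proof -
  obtain e where e: "\<And>v. v \<in> D \<Longrightarrow> dist (z 1) v \<le> e"
    using D bounded_any_center[of D "z 1"] by blast
  have "bdd_above ((\<lambda>v. Min ((\<lambda>j. dist v (z j)) ` {1..N})) ` D)"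
  proof (intro bdd_aboveI2)
    fix v assume "v \<in> D"
    have "Min ((\<lambda>j. dist v (z j)) ` {1..N}) \<le> dist v (z 1)"
      using N by (intro Min_le) auto
    then show "Min ((\<lambda>j. dist v (z j)) ` {1..N}) \<le> e"
      using e[OF \<open>v \<in> D\<close>] by (simp add: dist_commute)
  qed
  then have "Min ((\<lambda>j. dist w (z j)) ` {1..N}) \<le> fill_distance D z N"
    unfolding fill_distance_def using w by (rule cSUP_upper[rotated])
  moreover have "\<delta> \<le> Min ((\<lambda>j. dist w (z j)) ` {1..N})"
    using N far by (subst Min_ge_iff) auto
  ultimately show ?thesis by linarith
qed

text \<open>Letting \<open>c\<close> range over \<open>T\<close> covers two problems at once:
  \<open>T = {c}\<close> yields the discrete solution for \<open>c\<close>, and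
  \<open>T = UNIV\<close> the joint minimization over \<open>u\<close> and \<open>c\<close>. The
  constraints are affine in the pair, so \<open>C\<close> is affine. Boundedness of the samples lets
  the constraints pass to limits.\<close>

lemma constrained_minimizer_exists:
  fixes S :: "'a::euclidean_space set" and f g :: "'a \<Rightarrow> real"
  assumes hilbert: "hilbert_function_space \<Omega> H ip"
    and S: "open S \<or> closed S"
    and smooth: "\<And>v. v \<in> H \<Longrightarrow> smooth_enough k S v"
    and x: "\<And>j. j \<in> {1..N} \<Longrightarrow> x j \<in> S"
    and y: "\<And>j. surface_boundary k S \<noteq> {} \<Longrightarrow> j \<in> {1..Nb} \<Longrightarrow> y j \<in> surface_boundary k S"
    and bounded: "sampling_bounded k S x y N Nb H ip"
    and surjective: "sampling_surjective k S x y N Nb H"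
    and J: "J \<in> {1..N}" "g (x J) \<noteq> 0"
    and T: "closed T" "T \<noteq> {}" "\<And>a b t. a \<in> T \<Longrightarrow> b \<in> T \<Longrightarrow> (1 - t) * a + t * b \<in> T"
  defines "C \<equiv> {u \<in> H. \<exists>c\<in>T. sampled_values k S x y N Nb (\<lambda>j. of_real (f (x j) - c * g (x j))) (\<lambda>j. 0) u}"
  shows "\<exists>u\<in>C. \<forall>v\<in>C. hnorm ip u \<le> hnorm ip v"
proof -
  interpret hilbert_functions \<Omega> H ip
    by standard (rule hilbert)
  let ?B = "surface_boundary k S"
  have lap: "laplace_beltrami S (\<lambda>z. of_real a * u z + of_real b * v z) p =
      of_real a * laplace_beltrami S u p + of_real b * laplace_beltrami S v p"
    if "u \<in> H" "v \<in> H" "p \<in> S" for a b u v p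
    using smooth that S by (intro laplace_beltrami_lincomb) (auto simp: smooth_enough_def)
  have nor: "normal_derivative k S (\<lambda>z. of_real a * u z + of_real b * v z) p =
      of_real a * normal_derivative k S u p + of_real b * normal_derivative k S v p"
    if "u \<in> H" "v \<in> H" "p \<in> ?B" for a b u v p
    using smooth that by (intro normal_derivative_lincomb) (auto simp: smooth_enough_def)
  obtain K where K: "\<And>u j. u \<in> H \<Longrightarrow> j \<in> {1..N} \<Longrightarrow> cmod (laplace_beltrami S u (x j)) \<le> K * hnorm ip u"
    "\<And>u j. u \<in> H \<Longrightarrow> ?B \<noteq> {} \<Longrightarrow> j \<in> {1..Nb} \<Longrightarrow> cmod (normal_derivative k S u (y j)) \<le> K * hnorm ip u"
    using bounded unfolding sampling_bounded_def by blast
  show ?thesis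
  proof (rule minimal_norm_exists)
    show "C \<subseteq> H" by (auto simp: C_def)
    obtain c where "c \<in> T" using T(2) by blast
    then show "C \<noteq> {}"
      using surjective unfolding sampling_surjective_def C_def by blast
  next
    fix u v t assume "u \<in> C" "v \<in> C"
    then obtain a b where uv: "u \<in> H" "v \<in> H" and ab: "a \<in> T" "b \<in> T"
      and su: "sampled_values k S x y N Nb (\<lambda>j. of_real (f (x j) - a * g (x j))) (\<lambda>j. 0) u"
      and sv: "sampled_values k S x y N Nb (\<lambda>j. of_real (f (x j) - b * g (x j))) (\<lambda>j. 0) v"
      by (auto simp: C_def)
    let ?w = "\<lambda>z. of_real (1 - t) * u z + of_real t * v z"
    have "laplace_beltrami S ?w (x j) = of_real (f (x j) - ((1 - t) * a + t * b) * g (x j))"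
      if "j \<in> {1..N}" for j
    proof -
      have eqs: "laplace_beltrami S u (x j) = of_real (f (x j) - a * g (x j))"
        "laplace_beltrami S v (x j) = of_real (f (x j) - b * g (x j))"
        using su sv that unfolding sampled_values_def by blast+
      then show ?thesis
        unfolding lap[OF uv x[OF that]] eqs by (simp add: algebra_simps)
    qed
    moreover have "normal_derivative k S ?w (y j) = 0" if "?B \<noteq> {}" "j \<in> {1..Nb}" for j
      using su sv that unfolding sampled_values_def nor[OF uv y[OF that]] by simp
    ultimately show "?w \<in> C"
      using T(3)[OF ab, of t] lincomb_in[OF uv] unfolding C_def sampled_values_def by blast
  next
    fix s w
    assume s: "range s \<subseteq> C" and w: "w \<in> H"
      and lim: "(\<lambda>n. hnorm ip (\<lambda>z. s n z - w z)) \<longlonglongrightarrow> 0"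
    have sH: "s n \<in> H" for n using s by (auto simp: C_def)
    have "\<exists>c\<in>T. sampled_values k S x y N Nb (\<lambda>j. of_real (f (x j) - c * g (x j))) (\<lambda>j. 0) (s n)" for n
      using s by (auto simp: C_def)
    then obtain c where c: "\<And>n. c n \<in> T"
      "\<And>n. sampled_values k S x y N Nb (\<lambda>j. of_real (f (x j) - c n * g (x j))) (\<lambda>j. 0) (s n)"
      by metis
    have K0: "(\<lambda>n. K * hnorm ip (\<lambda>z. s n z - w z)) \<longlonglongrightarrow> 0"
      using tendsto_mult_right_zero[OF lim] .
    have lap_lim: "(\<lambda>n. laplace_beltrami S (s n) (x j)) \<longlonglongrightarrow> laplace_beltrami S w (x j)"
      if "j \<in> {1..N}" for j
    proof (rule LIM_zero_cancel, rule Lim_null_comparison[OF _ K0], rule always_eventually, rule allI)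
      fix n
      show "norm (laplace_beltrami S (s n) (x j) - laplace_beltrami S w (x j))
          \<le> K * hnorm ip (\<lambda>z. s n z - w z)"
        using K(1)[OF diff_in[OF sH w] that] lap[OF sH w x[OF that], where a = 1 and b = "-1"] by simp
    qed
    have nor_lim: "(\<lambda>n. normal_derivative k S (s n) (y j)) \<longlonglongrightarrow> normal_derivative k S w (y j)"
      if "?B \<noteq> {}" "j \<in> {1..Nb}" for j
    proof (rule LIM_zero_cancel, rule Lim_null_comparison[OF _ K0], rule always_eventually, rule allI)
      fix n
      show "norm (normal_derivative k S (s n) (y j) - normal_derivative k S w (y j))
          \<le> K * hnorm ip (\<lambda>z. s n z - w z)"
        using K(2)[OF diff_in[OF sH w] that] nor[OF sH w y[OF that], where a = 1 and b = "-1"] by simp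
    qed
    \<comment> \<open>Since \<open>g (x J) \<noteq> 0\<close>, the constraint at \<open>x J\<close>
      recovers \<open>c n\<close> continuously from \<open>s n\<close>. Hence the parameters
      converge along with the functions, even for unbounded \<open>T\<close>.\<close>
    define d where "d = (f (x J) - Re (laplace_beltrami S w (x J))) / g (x J)"
    have "(f (x J) - Re (laplace_beltrami S (s n) (x J))) / g (x J) = c n" for n
      using c(2)[of n] J by (simp add: sampled_values_def)
    moreover have "(\<lambda>n. (f (x J) - Re (laplace_beltrami S (s n) (x J))) / g (x J)) \<longlonglongrightarrow> d"
      unfolding d_def by (intro tendsto_intros lap_lim J)
    ultimately have c_lim: "c \<longlonglongrightarrow> d"
      by simp
    have "d \<in> T"
      using T(1) c(1) c_lim by (rule closed_sequentially)
    moreover have "laplace_beltrami S w (x j) = of_real (f (x j) - d * g (x j))" if j: "j \<in> {1..N}" for j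
    proof (rule LIMSEQ_unique[OF lap_lim[OF j]])
      have "laplace_beltrami S (s n) (x j) = of_real (f (x j) - c n * g (x j))" for n
        using c(2) j by (simp add: sampled_values_def)
      then show "(\<lambda>n. laplace_beltrami S (s n) (x j)) \<longlonglongrightarrow> of_real (f (x j) - d * g (x j))"
        by (simp only:) (intro tendsto_intros c_lim)
    qed
    moreover have "normal_derivative k S w (y j) = 0" if j: "?B \<noteq> {}" "j \<in> {1..Nb}" for j
    proof (rule LIMSEQ_unique[OF nor_lim[OF j]])
      show "(\<lambda>n. normal_derivative k S (s n) (y j)) \<longlonglongrightarrow> 0"
        using c(2) j by (simp add: sampled_values_def)
    qed
    ultimately show "w \<in> C"
      using w unfolding C_def sampled_values_def by blast
  qed
qed

section \<open>Convergence order of the minimizing constant\<close>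

theorem theorem3p1:
  fixes S \<Omega> :: "(real ^ 'm) set" and k :: nat
    and H :: "(real ^ 'm \<Rightarrow> complex) set"
    and ip :: "(real ^ 'm \<Rightarrow> complex) \<Rightarrow> (real ^ 'm \<Rightarrow> complex) \<Rightarrow> complex"
    and f g :: "real ^ 'm \<Rightarrow> real"
    and x y :: "nat \<Rightarrow> real ^ 'm"
    and bS :: "(real ^ 'm) set"
    and h :: "nat \<Rightarrow> nat \<Rightarrow> real"
    and u :: "nat \<Rightarrow> nat \<Rightarrow> real \<Rightarrow> real ^ 'm \<Rightarrow> complex"
    and p cstar :: real
    and ustar :: "real ^ 'm \<Rightarrow> complex"
  assumes domain: "integration_domain k S"
    and bS: "bS = surface_boundary k S"
    and Omega: "S \<union> bS \<subseteq> \<Omega>"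
    and finite_S: "set_integrable (hausdorff_measure k) S (\<lambda>_. 1 :: real)"
    and finite_bS: "set_integrable (hausdorff_measure (k - 1)) bS (\<lambda>_. 1 :: real)"
    and hilbert: "hilbert_function_space \<Omega> H ip"
    and smooth: "\<And>v. v \<in> H \<Longrightarrow> smooth_enough k S v"
    and divergence: "\<And>v. v \<in> H \<Longrightarrow> divergence_theorem k S v"
    and f: "continuous_on S f" "set_integrable (hausdorff_measure k) S f"
    and g: "continuous_on S g" "set_integrable (hausdorff_measure k) S g"
    and g_pos: "(LINT z:S|hausdorff_measure k. g z) > 0"
    and x_dense: "\<And>j. j \<ge> 1 \<Longrightarrow> x j \<in> S" "S \<subseteq> closure (x ` {1..})"
    and y_dense: "\<And>j. bS \<noteq> {} \<Longrightarrow> j \<ge> 1 \<Longrightarrow> y j \<in> bS" "bS \<noteq> {} \<Longrightarrow> bS \<subseteq> closure (y ` {1..})"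
    and bounded: "\<And>N Nb. sampling_bounded k S x y N Nb H ip"
    and surjective: "\<And>N Nb. sampling_surjective k S x y N Nb H"
    and u: "\<And>N Nb c. u N Nb c = discrete_solution k S H ip f g x y N Nb c"
    and h: "\<And>N Nb. h N Nb = h_max k S x y N Nb"
    and p: "p > 0"
    and order_p: "\<And>I :: real set. is_interval I \<Longrightarrow> bounded I \<Longrightarrow>
      \<exists>A>0. \<exists>B>0. \<exists>h0>0. \<forall>c\<in>I. \<forall>N\<ge>1. \<forall>Nb\<ge>1. h N Nb < h0 \<longrightarrow>
        (\<forall>z\<in>S. cmod (laplace_beltrami S (u N Nb c) z - of_real (f z - c * g z))
                 \<le> A * h N Nb powr p * hnorm ip (u N Nb c)) \<and>
        (\<forall>z\<in>bS. cmod (normal_derivative k S (u N Nb c) z)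
                 \<le> B * h N Nb powr p * hnorm ip (u N Nb c))"
    and cstar: "cstar = (LINT z:S|hausdorff_measure k. f z) / (LINT z:S|hausdorff_measure k. g z)"
    and ustar: "ustar \<in> H"
      "\<And>z. z \<in> S \<Longrightarrow> laplace_beltrami S ustar z = of_real (f z - cstar * g z)"
      "\<And>z. z \<in> bS \<Longrightarrow> normal_derivative k S ustar z = 0"
  shows "\<exists>A>0. \<exists>h1>0. \<forall>N\<ge>1. \<forall>Nb\<ge>1. h N Nb < h1 \<longrightarrow>
    \<bar>c_tilde k S H ip f g x y N Nb * (LINT z:S|hausdorff_measure k. g z)
       - (LINT z:S|hausdorff_measure k. f z)\<bar>
      \<le> A * h N Nb powr p * hnorm ip ustar"
proof -
  let ?\<mu> = "hausdorff_measure k" and ?\<nu> = "hausdorff_measure (k - 1)"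
  let ?G = "LINT z:S|?\<mu>. g z" and ?F = "LINT z:S|?\<mu>. f z"
  let ?c = "c_tilde k S H ip f g x y"
  interpret hilbert_functions \<Omega> H ip
    by standard (rule hilbert)
  have S_bounded: "bounded S" and S_top: "open S \<or> closed S"
    using domain by (auto simp: integration_domain_def compact_imp_bounded compact_imp_closed)

  \<comment> \<open>Otherwise the zero set of \<open>g\<close>, relatively closed in
    \<open>S\<close>, contains a dense set of points, so \<open>g\<close> vanishes on
    \<open>S\<close>, against the positive integral.\<close>
  have "\<exists>J\<ge>1. g (x J) \<noteq> 0"
  proof (rule ccontr)
    assume "\<not> ?thesis"
    then have zero: "x ` {1..} \<subseteq> {z \<in> S. g z = 0}"
      using x_dense(1) by auto
    obtain Z where Z: "closed Z" "{z \<in> S. g z = 0} = S \<inter> Z"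
      using continuous_closedin_preimage_constant[OF g(1), of 0] by (auto simp: closedin_closed)
    have "closure (x ` {1..}) \<subseteq> Z"
      using zero Z by (intro closure_minimal) auto
    then have "g z = 0" if "z \<in> S" for z
      using that x_dense(2) Z(2) by blast
    then have "(\<lambda>z. indicator S z *\<^sub>R g z) = (\<lambda>z. 0)"
      by (auto simp: indicator_def fun_eq_iff)
    then have "?G = 0"
      by (simp add: set_lebesgue_integral_def)
    with g_pos show False by simp
  qed
  then obtain J where J: "J \<ge> 1" "g (x J) \<noteq> 0" by blast

  have "\<exists>\<delta>>0. \<forall>N\<ge>1. \<forall>Nb. N < J \<longrightarrow> \<delta> \<le> h N Nb"
  proof -
    \<comment> \<open>The point \<open>x (Suc J)\<close> is at a fixed positive distance from the
      first \<open>J\<close> points, hence from the first \<open>N\<close> for \<open>N < J\<close>.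
      Taking \<open>Suc J\<close> instead of \<open>J\<close> keeps \<open>?D\<close> nonempty for
      \<open>J = 1\<close>.\<close>
    let ?w = "x (Suc J)" and ?D = "(\<lambda>j. dist (x (Suc J)) (x j)) ` {1..J}"
    have ne: "?w \<noteq> x j" if "j \<in> {1..J}" for j
    proof
      assume eq: "?w = x j"
      \<comment> \<open>Coinciding points could not carry the different values 0 and 1 that
        surjectivity allows to prescribe.\<close>
      obtain v where "sampled_values k S x y (Suc J) 0 (\<lambda>i. if i = j then 0 else 1) (\<lambda>i. 0) v"
        using surjective unfolding sampling_surjective_def by blast
      then have "laplace_beltrami S v ?w = 1" "laplace_beltrami S v (x j) = 0"
        using that by (auto simp: sampled_values_def)
      with eq show False by simp
    qed
    have "Min ?D \<le> h N Nb" if N: "N \<ge> 1" "N < J" for N Nb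
    proof -
      have "Min ?D \<le> fill_distance S x N"
        using S_bounded x_dense(1) N by (intro fill_distance_lower_bound[of _ ?w]) (auto intro!: Min_le)
      also have "\<dots> \<le> h N Nb"
        by (simp add: h h_max_def)
      finally show ?thesis .
    qed
    moreover have "Min ?D > 0"
      using ne J by (subst Min_gr_iff) auto
    ultimately show ?thesis by blast
  qed
  then obtain \<delta> where \<delta>: "\<delta> > 0" "\<And>N Nb. N \<ge> 1 \<Longrightarrow> h N Nb < \<delta> \<Longrightarrow> J \<le> N"
    by (metis linorder_not_le)

  let ?C = "\<lambda>N Nb T. {u \<in> H. \<exists>c\<in>T. sampled_values k S x y N Nb (\<lambda>j. of_real (f (x j) - c * g (x j))) (\<lambda>j. 0) u}"
  have min_exists: "\<exists>u\<in>?C N Nb T. \<forall>v\<in>?C N Nb T. hnorm ip u \<le> hnorm ip v"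
    if "J \<le> N" "closed T" "T \<noteq> {}" "\<And>a b t. a \<in> T \<Longrightarrow> b \<in> T \<Longrightarrow> (1 - t) * a + t * b \<in> T" for N Nb T
    using that J x_dense(1) y_dense(1) bS
    by (intro constrained_minimizer_exists[OF hilbert S_top smooth _ _ bounded surjective, where J = J])
      auto
  have u_min: "u N Nb c \<in> ?C N Nb {c}" "\<And>v. v \<in> ?C N Nb {c} \<Longrightarrow> hnorm ip (u N Nb c) \<le> hnorm ip v"
    if "J \<le> N" for N Nb c
  proof -
    have eq: "u N Nb c = arg_min_on (hnorm ip) (?C N Nb {c})"
      by (simp add: u discrete_solution_def)
    have "\<exists>u\<in>?C N Nb {c}. \<forall>v\<in>?C N Nb {c}. hnorm ip u \<le> hnorm ip v"
      using that by (intro min_exists) (auto simp: algebra_simps)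
    from arg_min_on_minimal[OF this]
    show "u N Nb c \<in> ?C N Nb {c}" "\<And>v. v \<in> ?C N Nb {c} \<Longrightarrow> hnorm ip (u N Nb c) \<le> hnorm ip v"
      unfolding eq by blast+
  qed
  have c_min: "hnorm ip (u N Nb (?c N Nb)) \<le> hnorm ip (u N Nb c)" if N: "J \<le> N" for N Nb c
  proof -
    \<comment> \<open>\<open>c_tilde\<close> is a choice, so a minimizing \<open>c\<close> must
      first be shown to exist. If \<open>w\<close> solves the joint problem with parameter
      \<open>d\<close>, then \<open>u N Nb d\<close> has norm at most that of \<open>w\<close>,
      hence at most that of every \<open>u N Nb b\<close>.\<close>
    have "\<exists>u\<in>?C N Nb UNIV. \<forall>v\<in>?C N Nb UNIV. hnorm ip u \<le> hnorm ip v"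
      using N by (intro min_exists) auto
    then obtain w d where w: "w \<in> ?C N Nb {d}" "\<And>v. v \<in> ?C N Nb UNIV \<Longrightarrow> hnorm ip w \<le> hnorm ip v"
      by blast
    have "hnorm ip (u N Nb d) \<le> hnorm ip (u N Nb b)" for b
    proof -
      have "hnorm ip (u N Nb d) \<le> hnorm ip w"
        using N w(1) by (rule u_min(2))
      also have "\<dots> \<le> hnorm ip (u N Nb b)"
        using u_min(1)[OF N, of Nb b] by (intro w(2)) auto
      finally show ?thesis .
    qed
    then have "\<exists>d\<in>UNIV. \<forall>b\<in>UNIV. hnorm ip (u N Nb d) \<le> hnorm ip (u N Nb b)"
      by blast
    from arg_min_on_minimal(2)[OF this, of c] show ?thesis
      by (simp add: c_tilde_def arg_min_on_def u)
  qed
  have norm_le: "hnorm ip (u N Nb (?c N Nb)) \<le> hnorm ip ustar" if N: "J \<le> N" for N Nb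
  proof -
    have "ustar \<in> ?C N Nb {cstar}"
      using ustar x_dense(1) y_dense(1) bS by (auto simp: sampled_values_def)
    from order_trans[OF c_min[OF N] u_min(2)[OF N this]] show ?thesis .
  qed

  \<comment> \<open>Boundedness of the single functional \<open>v \<mapsto> \<Delta>\<^sub>S v (x J)\<close> keeps the minimizers in a fixed interval.\<close>
  obtain K where K: "\<And>v. v \<in> H \<Longrightarrow> cmod (laplace_beltrami S v (x J)) \<le> K * hnorm ip v"
    using bounded[of J 0] J unfolding sampling_bounded_def by (metis atLeastAtMost_iff order_refl)
  \<comment> \<open>\<open>K\<close> comes from the fixed sample sizes \<open>J\<close> and
    \<open>0\<close>, so \<open>R\<close> is independent of \<open>N\<close> and \<open>Nb\<close>.
    Solving the constraint at \<open>x J\<close> for \<open>c\<close> gives the formula; the sign of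
    \<open>K\<close> is unknown, hence \<open>\<bar>K\<bar>\<close>.\<close>
  define R where "R = (\<bar>K\<bar> * hnorm ip ustar + \<bar>f (x J)\<bar>) / \<bar>g (x J)\<bar>"
  have c_bound: "?c N Nb \<in> {-R..R}" if N: "J \<le> N" for N Nb
  proof -
    let ?v = "u N Nb (?c N Nb)"
    have v: "?v \<in> H" "laplace_beltrami S ?v (x J) = of_real (f (x J) - ?c N Nb * g (x J))"
      using u_min(1)[OF N, of Nb "?c N Nb"] J N by (auto simp: sampled_values_def)
    have "\<bar>f (x J) - ?c N Nb * g (x J)\<bar> \<le> K * hnorm ip ?v"
      using K[OF v(1)] unfolding v(2) norm_of_real .
    also have "\<dots> \<le> \<bar>K\<bar> * hnorm ip ustar"
      using norm_le[OF N] hnorm_nonneg[OF v(1)] by (intro mult_mono) auto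
    finally have "\<bar>?c N Nb\<bar> * \<bar>g (x J)\<bar> \<le> \<bar>K\<bar> * hnorm ip ustar + \<bar>f (x J)\<bar>"
      unfolding abs_mult[symmetric] by linarith
    then have "\<bar>?c N Nb\<bar> \<le> R"
      using J by (simp add: R_def pos_le_divide_eq)
    then show ?thesis by auto
  qed

  \<comment> \<open>With the interval fixed beforehand, these constants serve all minimizers
    simultaneously.\<close>
  obtain A B h0 where AB: "A > 0" "B > 0" "h0 > 0"
    and order_S: "\<And>c N Nb z. c \<in> {-R..R} \<Longrightarrow> N \<ge> 1 \<Longrightarrow> Nb \<ge> 1 \<Longrightarrow> h N Nb < h0 \<Longrightarrow> z \<in> S \<Longrightarrow>
        cmod (laplace_beltrami S (u N Nb c) z - of_real (f z - c * g z))
          \<le> A * h N Nb powr p * hnorm ip (u N Nb c)"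
    and order_bS: "\<And>c N Nb z. c \<in> {-R..R} \<Longrightarrow> N \<ge> 1 \<Longrightarrow> Nb \<ge> 1 \<Longrightarrow> h N Nb < h0 \<Longrightarrow> z \<in> bS \<Longrightarrow>
        cmod (normal_derivative k S (u N Nb c) z) \<le> B * h N Nb powr p * hnorm ip (u N Nb c)"
    using order_p[of "{-R..R}"] by (auto simp: is_interval_cc)
  let ?mS = "LINT z:S|?\<mu>. (1::real)" and ?mB = "LINT z:bS|?\<nu>. (1::real)"
  have m_nonneg: "?mS \<ge> 0" "?mB \<ge> 0"
    by (auto simp: set_lebesgue_integral_def)
  \<comment> \<open>The constant weights the residual bounds with the measures of \<open>S\<close>
    and \<open>bS\<close>; the summand 1 makes it positive, as the measures are only used as
    nonnegative numbers.\<close>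
  have main: "\<bar>?c N Nb * ?G - ?F\<bar> \<le> (A * ?mS + B * ?mB + 1) * h N Nb powr p * hnorm ip ustar"
    if N: "N \<ge> 1" "Nb \<ge> 1" "h N Nb < min \<delta> h0" for N Nb
  proof -
    let ?v = "u N Nb (?c N Nb)" and ?e = "h N Nb powr p * hnorm ip (u N Nb (?c N Nb))"
    have JN: "J \<le> N" using \<delta>(2)[of N Nb] N by simp
    have vH: "?v \<in> H" using u_min(1)[OF JN, of Nb "?c N Nb"] by simp
    have int_lap: "set_integrable ?\<mu> S (laplace_beltrami S ?v)"
      and int_nor: "set_integrable ?\<nu> bS (normal_derivative k S ?v)"
      and gauss: "(LINT z:S|?\<mu>. laplace_beltrami S ?v z) = (LINT z:bS|?\<nu>. normal_derivative k S ?v z)"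
      using divergence[OF vH] bS by (auto simp: divergence_theorem_def)
    let ?q = "\<lambda>z. f z - ?c N Nb * g z"
    have int_q: "set_integrable ?\<mu> S ?q"
      using f(2) g(2) by (intro set_integral_diff(1) set_integrable_mult_right)
    have "(\<lambda>z. indicator S z *\<^sub>R complex_of_real (?q z)) = (\<lambda>z. complex_of_real (indicator S z *\<^sub>R ?q z))"
      by (simp add: scaleR_conv_of_real)
    with int_q have int_q': "set_integrable ?\<mu> S (\<lambda>z. complex_of_real (?q z))"
      unfolding set_integrable_def by (simp only: complex_of_real_integrable_eq)
    have "(LINT z:S|?\<mu>. ?q z) = ?F - ?c N Nb * ?G"
      using f(2) g(2) by (simp add: set_integral_diff set_integrable_mult_right)
    then have "of_real (?F - ?c N Nb * ?G) = (LINT z:S|?\<mu>. complex_of_real (?q z))"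
      by (simp only: set_integral_complex_of_real)
    \<comment> \<open>Write \<open>?q\<close> as the Laplacian minus the residual and turn the
      integral of the Laplacian into a boundary integral. What remains are two residuals, both small
      by the order of the method; on a closed surface the boundary integral is over the empty
      set.\<close>
    also have "\<dots> = (LINT z:bS|?\<nu>. normal_derivative k S ?v z)
        - (LINT z:S|?\<mu>. laplace_beltrami S ?v z - complex_of_real (?q z))"
      using set_integral_diff(2)[OF int_lap int_q'] gauss by simp
    finally have "\<bar>?F - ?c N Nb * ?G\<bar> = cmod ((LINT z:bS|?\<nu>. normal_derivative k S ?v z)
        - (LINT z:S|?\<mu>. laplace_beltrami S ?v z - complex_of_real (?q z)))"
      by (simp flip: norm_of_real[where 'a = complex])
    also have "\<dots> \<le> cmod (LINT z:bS|?\<nu>. normal_derivative k S ?v z)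
        + cmod (LINT z:S|?\<mu>. laplace_beltrami S ?v z - complex_of_real (?q z))"
      by (rule norm_triangle_ineq4)
    also have "\<dots> \<le> B * h N Nb powr p * hnorm ip ?v * ?mB + A * h N Nb powr p * hnorm ip ?v * ?mS"
    proof (intro add_mono norm_set_integral_le_const)
      show "set_integrable ?\<mu> S (\<lambda>z. laplace_beltrami S ?v z - complex_of_real (?q z))"
        using int_lap int_q' by (rule set_integral_diff(1))
    qed (use int_nor finite_S finite_bS N order_S[OF c_bound[OF JN]] order_bS[OF c_bound[OF JN]]
      in \<open>simp_all del: of_real_diff of_real_mult\<close>)
    also have "\<dots> = (A * ?mS + B * ?mB) * h N Nb powr p * hnorm ip ?v"
      by (simp add: algebra_simps)
    also have "\<dots> \<le> (A * ?mS + B * ?mB + 1) * h N Nb powr p * hnorm ip ustar"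
      using norm_le[OF JN] hnorm_nonneg[OF vH] AB m_nonneg by (intro mult_mono) auto
    finally show ?thesis by linarith
  qed
  have "A * ?mS + B * ?mB + 1 > 0"
    using AB m_nonneg by (intro add_nonneg_pos add_nonneg_nonneg) auto
  moreover have "min \<delta> h0 > 0"
    using \<delta>(1) AB by simp
  ultimately show ?thesis
    using main by blast
qed

end
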